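(* Let $G$ be a countable discrete amenable group with summable Følner sequence $(\mathcal F_n)_n$, and let $\big(C^*_r(G)\xrightarrow{\psi_n}M_{\mathcal F_n}(\mathbb C)\xrightarrow{\varphi_n}C^*_r(G)\big)_n$ be the summable system of c.p.c. approximations of $C^*_r(G)$ built from $(\mathcal F_n)_n$ by compression, as specified in the context. If $G$ contains an element of infinite order, then the maps $(\psi_n)_n$ are not approximately multiplicative (that is, it is not the case that $\lim_n\|\psi_n(ab)-\psi_n(a)\psi_n(b)\|=0$ for all $a,b\in C^*_r(G)$), and the associated $C^*$-encoding system $(M_{\mathcal F_n}(\mathbb C),\psi_{n+1}\circ\varphi_n)_n$ is neither NF nor $\mathrm{CPC}^*$.
   Context: Let $\lambda\colon G\to B(\ell^2(G))$, $\lambda_g\delta_h=\delta_{gh}$, be the left regular representation and $C^*_r(G)\subset B(\ell^2(G))$ the reduced group $C^*$-algebra, generated by $\lambda(G)$. A Følner sequence for $G$ is a sequence $(\mathcal F_n)_{n\ge0}$ of finite nonempty subsets of $G$ with $|\mathcal F_n\Delta s\mathcal F_n|/|\mathcal F_n|\to0$ for all $s\in G$. It is summable if there is a decreasing sequence $(\varepsilon_n)_n$ of non-negative reals with $\sum_n\varepsilon_n\le1$ such that for all $m>n\ge0$, $$\max_{g,h\in\mathcal F_n}\left(1-\frac{|\mathcal F_m\cap gh^{-1}\mathcal F_m|}{|\mathcal F_m|}\right)|\mathcal F_n|<\varepsilon_m .$$ Let $P_n$ be the projection of $\ell^2(G)$ onto the span of $\{\delta_g: g\in\mathcal F_n\}$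 and identify $P_nB(\ell^2(G))P_n$ with $M_{\mathcal F_n}(\mathbb C)$, with canonical matrix units $\{e_{g,h}\}_{g,h\in\mathcal F_n}$. Define unital completely positive maps $\psi_n\colon C^*_r(G)\to M_{\mathcal F_n}(\mathbb C)$ by $\psi_n(a)=P_naP_n$, so that $\psi_n(\lambda_s)=\sum_{r\in\mathcal F_n\cap s\mathcal F_n}e_{r,s^{-1}r}$ for $s\in G$, and $\varphi_n\colon M_{\mathcal F_n}(\mathbb C)\to C^*_r(G)$ by $\varphi_n(e_{g,h})=\frac1{|\mathcal F_n|}\lambda_{gh^{-1}}$ for $g,h\in\mathcal F_n$. Write $F_n=M_{\mathcal F_n}(\mathbb C)$, $\rho_{n+1,n}=\psi_{n+1}\circ\varphi_n$, $\rho_{m,n}=\rho_{m,m-1}\circ\cdots\circ\rho_{n+1,n}$ for $m>n$, $\rho_{n,n}=\mathrm{id}_{F_n}$. (The system $(F_n,\rho_{n+1,n})_n$ is known to be $C^*$-encoding: for any $k\ge0$, $x,y\in F_k$, $\varepsilon>0$ there is $M>k$ with $\|\rho_{m,n}(\rho_{n,k}(x)\rho_{n,k}(y))-\rho_{m,j}(\rho_{j,k}(x)\rho_{j,k}(y))\|<\varepsilon$ for all $n,j>M$ and $m>\max\{n,j\}$.) The system is NF if for any $k\ge0$, $x,y\in F_k$, $\varepsilon>0$ there is $M>k$ such that for all $m>n>M$, $\|\rho_{m,k}(x)\rho_{m,k}(y)-\rho_{m,n}(\rho_{n,k}(x)\rho_{n,k}(y))\|<\varepsilon$. It is $\mathrm{CPC}^*$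 if for any $k\ge0$, $x,y\in F_k$, $\varepsilon>0$ there is $M>k$ such that for all $n,j>M$ and $m>\max\{n,j\}$, $\|\rho_{m,k}(x)\rho_{m,k}(y)-\rho_{m,j}(1_{F_j})\rho_{m,n}(\rho_{n,k}(x)\rho_{n,k}(y))\|<\varepsilon$. *)

theory Defs
  imports "HOL-Analysis.Analysis" "HOL-Algebra.Multiplicative_Group" "HOL-Algebra.Coset"
begin

section \<open>The Hilbert space of square-summable functions\<close>

typedef 'a ell2 = "{f :: 'a \<Rightarrow> complex. (\<lambda>x. (cmod (f x))\<^sup>2) summable_on UNIV}"
  morphisms ell2_fun Abs_ell2
  by (rule exI[of _ "\<lambda>_. 0"]) simp

setup_lifting type_definition_ell2

lemma ell2_summable: "(\<lambda>x. (cmod (ell2_fun f x))\<^sup>2) summable_on UNIV"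
  using ell2_fun[of f] by simp

lemma ell2_eqI: "(\<And>x. ell2_fun f x = ell2_fun g x) \<Longrightarrow> f = g"
  by (metis ell2_fun_inject ext)

lemma square_summable_add:
  fixes f g :: "'a \<Rightarrow> complex"
  assumes "(\<lambda>x. (cmod (f x))\<^sup>2) summable_on UNIV" "(\<lambda>x. (cmod (g x))\<^sup>2) summable_on UNIV"
  shows "(\<lambda>x. (cmod (f x + g x))\<^sup>2) summable_on UNIV"
proof (rule summable_on_comparison_test)
  show "(\<lambda>x. 2 * ((cmod (f x))\<^sup>2 + (cmod (g x))\<^sup>2)) summable_on UNIV"
    by (intro summable_on_cmult_right summable_on_add assms)
  fix x
  have "(cmod (f x + g x))\<^sup>2 \<le> (cmod (f x) + cmod (g x))\<^sup>2"
    by (intro power_mono norm_triangle_ineq) auto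
  also have "\<dots> \<le> 2 * ((cmod (f x))\<^sup>2 + (cmod (g x))\<^sup>2)"
    using sum_squares_bound[of "cmod (f x)" "cmod (g x)"] by (simp add: power2_sum)
  finally show "(cmod (f x + g x))\<^sup>2 \<le> 2 * ((cmod (f x))\<^sup>2 + (cmod (g x))\<^sup>2)" .
qed auto

lemma square_summable_scale:
  fixes f :: "'a \<Rightarrow> complex"
  assumes "(\<lambda>x. (cmod (f x))\<^sup>2) summable_on UNIV"
  shows "(\<lambda>x. (cmod (c * f x))\<^sup>2) summable_on UNIV"
  by (simp add: norm_mult power_mult_distrib summable_on_cmult_right assms)

lemma square_summable_mono:
  fixes f g :: "'a \<Rightarrow> complex"
  assumes "(\<lambda>x. (cmod (f x))\<^sup>2) summable_on UNIV" "\<And>x. cmod (g x) \<le> cmod (f x)"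
  shows "(\<lambda>x. (cmod (g x))\<^sup>2) summable_on UNIV"
  by (rule summable_on_comparison_test[OF assms(1)]) (auto intro: power_mono assms(2))

lemma square_summable_inner:
  fixes f g :: "'a \<Rightarrow> complex"
  assumes "(\<lambda>x. (cmod (f x))\<^sup>2) summable_on UNIV" "(\<lambda>x. (cmod (g x))\<^sup>2) summable_on UNIV"
  shows "(\<lambda>x. cnj (f x) * g x) summable_on UNIV"
proof (rule abs_summable_summable, rule summable_on_comparison_test)
  show "(\<lambda>x. (cmod (f x))\<^sup>2 + (cmod (g x))\<^sup>2) summable_on UNIV"
    by (intro summable_on_add assms)
  fix x
  have "2 * (cmod (f x) * cmod (g x)) \<le> (cmod (f x))\<^sup>2 + (cmod (g x))\<^sup>2"
    using sum_squares_bound[of "cmod (f x)" "cmod (g x)"] by simp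
  moreover have "0 \<le> cmod (f x) * cmod (g x)" by simp
  ultimately have "cmod (f x) * cmod (g x) \<le> (cmod (f x))\<^sup>2 + (cmod (g x))\<^sup>2" by linarith
  then show "norm (cnj (f x) * g x) \<le> (cmod (f x))\<^sup>2 + (cmod (g x))\<^sup>2"
    by (simp only: norm_mult complex_mod_cnj)
qed auto

instantiation ell2 :: (type) real_inner
begin

lift_definition zero_ell2 :: "'a ell2" is "\<lambda>_. 0" by simp
lift_definition plus_ell2 :: "'a ell2 \<Rightarrow> 'a ell2 \<Rightarrow> 'a ell2" is "\<lambda>f g x. f x + g x"
  by (simp add: square_summable_add)
lift_definition uminus_ell2 :: "'a ell2 \<Rightarrow> 'a ell2" is "\<lambda>f x. - f x" by simp
lift_definition minus_ell2 :: "'a ell2 \<Rightarrow> 'a ell2 \<Rightarrow> 'a ell2" is "\<lambda>f g x. f x - g x"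
  using square_summable_add[of _ "\<lambda>x. - _ x"] by simp
lift_definition scaleR_ell2 :: "real \<Rightarrow> 'a ell2 \<Rightarrow> 'a ell2" is "\<lambda>r f x. complex_of_real r * f x"
  by (rule square_summable_scale)
definition inner_ell2 :: "'a ell2 \<Rightarrow> 'a ell2 \<Rightarrow> real" where
  "inner_ell2 f g = Re (\<Sum>\<^sub>\<infinity>x. cnj (ell2_fun f x) * ell2_fun g x)"
definition norm_ell2 :: "'a ell2 \<Rightarrow> real" where
  "norm_ell2 f = sqrt (\<Sum>\<^sub>\<infinity>x. (cmod (ell2_fun f x))\<^sup>2)"
definition sgn_ell2 :: "'a ell2 \<Rightarrow> 'a ell2" where
  "sgn_ell2 f = inverse (norm f) *\<^sub>R f"
definition dist_ell2 :: "'a ell2 \<Rightarrow> 'a ell2 \<Rightarrow> real" where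
  "dist_ell2 f g = norm (f - g)"
definition uniformity_ell2 :: "('a ell2 \<times> 'a ell2) filter" where
  "uniformity_ell2 = (INF e\<in>{0<..}. principal {(f, g). dist f g < e})"
definition open_ell2 :: "'a ell2 set \<Rightarrow> bool" where
  "open_ell2 U = (\<forall>f\<in>U. eventually (\<lambda>(f', g). f' = f \<longrightarrow> g \<in> U) uniformity)"

lemma inner_ell2_self: "inner f f = (\<Sum>\<^sub>\<infinity>x. (cmod (ell2_fun f x))\<^sup>2)" for f :: "'a ell2"
proof -
  have "(\<lambda>x. cnj (ell2_fun f x) * ell2_fun f x) summable_on UNIV"
    by (intro square_summable_inner ell2_summable)
  then have "inner f f = (\<Sum>\<^sub>\<infinity>x. Re (cnj (ell2_fun f x) * ell2_fun f x))"
    unfolding inner_ell2_def by (simp only: infsum_Re)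
  moreover have "Re (cnj z * z) = (cmod z)\<^sup>2" for z
    by (simp only: cmod_power2) (simp add: power2_eq_square)
  ultimately show ?thesis
    by simp
qed

instance
proof
  fix f g h :: "'a ell2" and r s :: real
  show "f + g + h = f + (g + h)" by transfer (simp add: add.assoc)
  show "f + g = g + f" by transfer (simp add: add.commute)
  show "0 + f = f" by transfer simp
  show "- f + f = 0" by transfer simp
  show "f - g = f + - g" by transfer simp
  show "r *\<^sub>R (f + g) = r *\<^sub>R f + r *\<^sub>R g" by transfer (simp add: algebra_simps)
  show "(r + s) *\<^sub>R f = r *\<^sub>R f + s *\<^sub>R f" by transfer (simp add: algebra_simps)
  show "r *\<^sub>R s *\<^sub>R f = (r * s) *\<^sub>R f" by transfer (simp add: algebra_simps)
  show "1 *\<^sub>R f = f" by transfer simp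
  show "sgn f = inverse (norm f) *\<^sub>R f" by (rule sgn_ell2_def)
  show "dist f g = norm (f - g)" by (rule dist_ell2_def)
  show "uniformity = (INF e\<in>{0<..}. principal {(f::'a ell2, g). dist f g < e})"
    by (rule uniformity_ell2_def)
  show "open U = (\<forall>f\<in>U. eventually (\<lambda>(f', g). f' = f \<longrightarrow> g \<in> U) uniformity)"
    for U :: "'a ell2 set" by (rule open_ell2_def)
  have S: "(\<lambda>x. cnj (ell2_fun u x) * ell2_fun v x) summable_on UNIV" for u v :: "'a ell2"
    by (intro square_summable_inner ell2_summable)
  have "(\<Sum>\<^sub>\<infinity>x. cnj (ell2_fun g x) * ell2_fun f x) = cnj (\<Sum>\<^sub>\<infinity>x. cnj (ell2_fun f x) * ell2_fun g x)"
    by (simp add: mult.commute flip: infsum_cnj)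
  then show "inner f g = inner g f"
    by (simp add: inner_ell2_def)
  show "inner (f + g) h = inner f h + inner g h"
    by (simp add: inner_ell2_def plus_ell2.rep_eq distrib_right infsum_add S)
  show "inner (r *\<^sub>R f) g = r * inner f g"
    by (simp add: inner_ell2_def scaleR_ell2.rep_eq mult.assoc infsum_cmult_right S)
  show "0 \<le> inner f f"
    unfolding inner_ell2_self by (rule infsum_nonneg) simp
  show "inner f f = 0 \<longleftrightarrow> f = 0"
  proof
    assume "inner f f = 0"
    then have "(cmod (ell2_fun f x))\<^sup>2 = 0" for x
      using nonneg_infsum_le_0D[OF _ ell2_summable, of f x] by (simp add: inner_ell2_self)
    then show "f = 0" by (intro ell2_eqI) (simp add: zero_ell2.rep_eq)
  next
    assume "f = 0"
    then show "inner f f = 0" unfolding inner_ell2_self by (simp add: zero_ell2.rep_eq)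
  qed
  show "norm f = sqrt (inner f f)"
    by (simp add: norm_ell2_def inner_ell2_self)
qed

end

lift_definition ell2_delta :: "'a \<Rightarrow> 'a ell2" is "\<lambda>h x. if x = h then 1 else 0"
proof -
  fix h :: 'a
  have "(\<lambda>x. (cmod (if x = h then 1 else 0))\<^sup>2) summable_on {h}" by simp
  then show "(\<lambda>x. (cmod (if x = h then 1 else 0))\<^sup>2) summable_on UNIV"
    by (rule summable_on_cong_neutral[THEN iffD1, rotated -1]) auto
qed

definition cinner_ell2 :: "'a ell2 \<Rightarrow> 'a ell2 \<Rightarrow> complex" where
  "cinner_ell2 f g = (\<Sum>\<^sub>\<infinity>x. cnj (ell2_fun f x) * ell2_fun g x)"


section \<open>Operators\<close>

text \<open>The type below consists of the bounded \<^emph>\<open>real\<close>-linear operators; complex linearity is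
  imposed in the definition of \<open>l2_ops\<close>.\<close>

type_synonym 'a l2op = "'a ell2 \<Rightarrow>\<^sub>L 'a ell2"

lemma l2op_eq_iff: "T = U \<longleftrightarrow> (\<forall>f. blinfun_apply T f = blinfun_apply U f)" for T U :: "'a l2op"
  by (auto intro: blinfun_eqI)

lemma norm_ell2_mono:
  assumes "\<And>x. cmod (ell2_fun f x) \<le> cmod (ell2_fun g x)"
  shows "norm f \<le> norm g"
  unfolding norm_ell2_def
  by (intro real_sqrt_le_mono infsum_mono ell2_summable power_mono assms) auto

lift_definition ell2_scale :: "complex \<Rightarrow> 'a ell2 \<Rightarrow> 'a ell2" is "\<lambda>c f x. c * f x"
  by (rule square_summable_scale)

lemma norm_ell2_scale: "norm (ell2_scale c f) = cmod c * norm f"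
  by (simp add: norm_ell2_def ell2_scale.rep_eq norm_mult power_mult_distrib infsum_cmult_right'
      real_sqrt_mult)

lift_definition scalar_op :: "complex \<Rightarrow> 'a l2op" is ell2_scale
proof (rule bounded_linear_intro)
  fix c :: complex and f g :: "'a ell2" and r :: real
  show "ell2_scale c (f + g) = ell2_scale c f + ell2_scale c g"
    by transfer (simp add: algebra_simps)
  show "ell2_scale c (r *\<^sub>R f) = r *\<^sub>R ell2_scale c f"
    by transfer (simp add: algebra_simps)
  show "norm (ell2_scale c f) \<le> norm f * cmod c"
    by (simp add: norm_ell2_scale mult.commute)
qed

lift_definition ell2_restrict :: "'a set \<Rightarrow> 'a ell2 \<Rightarrow> 'a ell2" is
  "\<lambda>S f x. if x \<in> S then f x else 0"
  by (erule square_summable_mono) simp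

text \<open>The orthogonal projection onto the closed span of the \<open>\<delta>\<^sub>g\<close> with \<open>g \<in> S\<close>.\<close>

lift_definition l2_proj :: "'a set \<Rightarrow> 'a l2op" is ell2_restrict
proof (rule bounded_linear_intro)
  fix S :: "'a set" and f g :: "'a ell2" and r :: real
  show "ell2_restrict S (f + g) = ell2_restrict S f + ell2_restrict S g"
    by (rule ell2_eqI) (simp add: ell2_restrict.rep_eq plus_ell2.rep_eq)
  show "ell2_restrict S (r *\<^sub>R f) = r *\<^sub>R ell2_restrict S f"
    by (rule ell2_eqI) (simp add: ell2_restrict.rep_eq scaleR_ell2.rep_eq)
  show "norm (ell2_restrict S f) \<le> norm f * 1"
    by (simp add: norm_ell2_mono ell2_restrict.rep_eq)
qed

text \<open>\<open>B(\<ell>\<^sup>2(S))\<close> for a subset \<open>S\<close> of the ambient type, realised as the corner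
  \<open>P\<^sub>S B P\<^sub>S\<close>; its unit is \<open>l2_proj S\<close>. For \<open>S\<close> the carrier of a group \<open>G\<close> this is
  \<open>B(\<ell>\<^sup>2(G))\<close>, and for a finite \<open>S\<close> it is the matrix algebra \<open>M\<^sub>S(\<complex>)\<close>.\<close>

definition l2_ops :: "'a set \<Rightarrow> 'a l2op set" where
  "l2_ops S = {T. (\<forall>c. T o\<^sub>L scalar_op c = scalar_op c o\<^sub>L T) \<and> l2_proj S o\<^sub>L T o\<^sub>L l2_proj S = T}"

definition adjoint_ops :: "'a l2op \<Rightarrow> 'a l2op \<Rightarrow> bool" where
  "adjoint_ops T T' \<longleftrightarrow> (\<forall>f g. cinner_ell2 (T f) g = cinner_ell2 f (T' g))"

definition cstar_subalgebra :: "'a set \<Rightarrow> 'a l2op set \<Rightarrow> bool" where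
  "cstar_subalgebra S A \<longleftrightarrow> A \<subseteq> l2_ops S \<and> 0 \<in> A \<and>
     (\<forall>T\<in>A. \<forall>U\<in>A. T + U \<in> A \<and> T o\<^sub>L U \<in> A) \<and>
     (\<forall>c. \<forall>T\<in>A. scalar_op c o\<^sub>L T \<in> A) \<and>
     (\<forall>T\<in>A. \<forall>T'. adjoint_ops T T' \<longrightarrow> T' \<in> A) \<and>
     closed A"

lemma cinner_ell2_summable: "(\<lambda>x. cnj (ell2_fun f x) * ell2_fun g x) summable_on UNIV"
  by (intro square_summable_inner ell2_summable)

lemma cinner_ell2_scale_right: "cinner_ell2 f (ell2_scale c g) = c * cinner_ell2 f g"
proof -
  have "cinner_ell2 f (ell2_scale c g) = (\<Sum>\<^sub>\<infinity>x. c * (cnj (ell2_fun f x) * ell2_fun g x))"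
    by (simp add: cinner_ell2_def ell2_scale.rep_eq mult.left_commute)
  then show ?thesis
    by (simp add: infsum_cmult_right cinner_ell2_summable cinner_ell2_def)
qed

lemma cinner_ell2_restrict: "cinner_ell2 (ell2_restrict S f) g = cinner_ell2 f (ell2_restrict S g)"
  unfolding cinner_ell2_def by (rule infsum_cong) (simp add: ell2_restrict.rep_eq)

lemma cinner_ell2_ext:
  assumes "\<And>f. cinner_ell2 f g = cinner_ell2 f h"
  shows "g = h"
proof -
  have "inner f g = inner f h" for f
    using assms[of f] by (simp add: inner_ell2_def cinner_ell2_def)
  then have "inner (g - h) (g - h) = 0"
    by (simp add: inner_diff_right)
  then show ?thesis by simp
qed

lemma cstar_subalgebra_l2_ops: "cstar_subalgebra S (l2_ops S)"
proof -
  let ?P = "l2_proj S"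
  have app: "T \<in> l2_ops S \<longleftrightarrow> (\<forall>c f. T (ell2_scale c f) = ell2_scale c (T f)) \<and>
      (\<forall>f. ell2_restrict S (T (ell2_restrict S f)) = T f)" for T
    by (auto simp: l2_ops_def l2op_eq_iff scalar_op.rep_eq l2_proj.rep_eq)
  have scale_add: "ell2_scale c (f + g) = ell2_scale c f + ell2_scale c g" for c and f g :: "'a ell2"
    by transfer (simp add: algebra_simps)
  have restrict_add: "ell2_restrict S (f + g) = ell2_restrict S f + ell2_restrict S g"
    for f g :: "'a ell2"
    by (rule ell2_eqI) (simp add: ell2_restrict.rep_eq plus_ell2.rep_eq)
  have scale_scale: "ell2_scale c (ell2_scale d f) = ell2_scale d (ell2_scale c f)"
    for c d and f :: "'a ell2"
    by transfer (simp add: algebra_simps)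
  have scale_0: "ell2_scale c 0 = 0" and restrict_0: "ell2_restrict S 0 = 0" for c
    by (rule ell2_eqI; simp add: ell2_scale.rep_eq ell2_restrict.rep_eq zero_ell2.rep_eq)+
  have restrict_scale: "ell2_restrict S (ell2_scale c f) = ell2_scale c (ell2_restrict S f)"
    for c and f :: "'a ell2"
    by (rule ell2_eqI) (simp add: ell2_scale.rep_eq ell2_restrict.rep_eq)
  have idem: "ell2_restrict S (ell2_restrict S f) = ell2_restrict S f" for f :: "'a ell2"
    by (rule ell2_eqI) (simp add: ell2_restrict.rep_eq)
  have left: "ell2_restrict S (T f) = T f" and right: "T (ell2_restrict S f) = T f"
    if "T \<in> l2_ops S" for T f
    using that unfolding app by (metis idem)+
  have closed: "closed (l2_ops S)"
  proof -
    have "l2_ops S = (\<Inter>c. {T. T o\<^sub>L scalar_op c = scalar_op c o\<^sub>L T}) \<inter> {T. ?P o\<^sub>L T o\<^sub>L ?P = T}"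
      by (auto simp: l2_ops_def)
    then show ?thesis
      by (auto intro!: closed_Int closed_INT closed_Collect_eq continuous_intros)
  qed
  have adj: "T' \<in> l2_ops S" if T: "T \<in> l2_ops S" and a: "adjoint_ops T T'" for T T'
    unfolding app
  proof (intro conjI allI)
    fix c and f :: "'a ell2"
    have a: "cinner_ell2 g (T' f) = cinner_ell2 (T g) f" for f g
      using a by (simp add: adjoint_ops_def)
    show "T' (ell2_scale c f) = ell2_scale c (T' f)"
      by (rule cinner_ell2_ext) (simp add: a cinner_ell2_scale_right)
    show "ell2_restrict S (T' (ell2_restrict S f)) = T' f"
      by (rule cinner_ell2_ext)
        (simp add: a left[OF T] right[OF T] flip: cinner_ell2_restrict)
  qed
  show ?thesis
    unfolding cstar_subalgebra_def
  proof (intro conjI ballI allI impI)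
    show "0 \<in> l2_ops S"
      by (simp add: app scale_0 restrict_0)
    fix T assume T: "T \<in> l2_ops S"
    show "scalar_op c o\<^sub>L T \<in> l2_ops S" for c
      using T unfolding app by (simp add: scalar_op.rep_eq restrict_scale) (metis scale_scale)
    show "T' \<in> l2_ops S" if "adjoint_ops T T'" for T'
      using adj T that .
    fix U assume U: "U \<in> l2_ops S"
    show "T + U \<in> l2_ops S"
      using T U unfolding app by (simp add: plus_blinfun.rep_eq scale_add restrict_add)
    show "T o\<^sub>L U \<in> l2_ops S"
      using T U left[OF T] right[OF U] unfolding app by simp
  qed (use closed in auto)
qed

definition matrix_entry :: "'a l2op \<Rightarrow> 'a \<Rightarrow> 'a \<Rightarrow> complex" where
  "matrix_entry T g h = ell2_fun (T (ell2_delta h)) g"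


section \<open>The reduced group C*-algebra\<close>

text \<open>As an element of the corner \<open>B(\<ell>\<^sup>2(G))\<close>, \<open>\<lambda>\<^sub>g\<close> vanishes on functions supported off the
  carrier.\<close>

definition left_reg :: "('a, 'b) monoid_scheme \<Rightarrow> 'a \<Rightarrow> 'a l2op" where
  "left_reg G g = Blinfun (\<lambda>f. Abs_ell2
     (\<lambda>h. if h \<in> carrier G then ell2_fun f (inv\<^bsub>G\<^esub> g \<otimes>\<^bsub>G\<^esub> h) else 0))"

definition reduced_cstar :: "('a, 'b) monoid_scheme \<Rightarrow> 'a l2op set" where
  "reduced_cstar G = \<Inter>{A. cstar_subalgebra (carrier G) A \<and> left_reg G ` carrier G \<subseteq> A}"

lemma (in group) left_reg_square_summable:
  assumes g: "g \<in> carrier G"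
  shows "(\<lambda>h. (cmod (if h \<in> carrier G then ell2_fun f (inv g \<otimes> h) else 0))\<^sup>2) summable_on UNIV"
    and "(\<Sum>\<^sub>\<infinity>h. (cmod (if h \<in> carrier G then ell2_fun f (inv g \<otimes> h) else 0))\<^sup>2)
           = (\<Sum>\<^sub>\<infinity>h\<in>carrier G. (cmod (ell2_fun f h))\<^sup>2)"
proof -
  have bij: "bij_betw (\<lambda>h. inv g \<otimes> h) (carrier G) (carrier G)"
    by (rule bij_betwI[where g = "\<lambda>h. g \<otimes> h"]) (use g in \<open>auto simp: m_assoc[symmetric]\<close>)
  have "(\<lambda>h. (cmod (ell2_fun f h))\<^sup>2) summable_on carrier G"
    by (rule summable_on_subset_banach[OF ell2_summable]) simp
  then have "(\<lambda>h. (cmod (ell2_fun f (inv g \<otimes> h)))\<^sup>2) summable_on carrier G"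
    using summable_on_reindex_bij_betw[OF bij, of "\<lambda>h. (cmod (ell2_fun f h))\<^sup>2"] by simp
  then show "(\<lambda>h. (cmod (if h \<in> carrier G then ell2_fun f (inv g \<otimes> h) else 0))\<^sup>2) summable_on UNIV"
    by (rule summable_on_cong_neutral[THEN iffD1, rotated -1]) auto
  have "(\<Sum>\<^sub>\<infinity>h. (cmod (if h \<in> carrier G then ell2_fun f (inv g \<otimes> h) else 0))\<^sup>2)
      = (\<Sum>\<^sub>\<infinity>h\<in>carrier G. (cmod (ell2_fun f (inv g \<otimes> h)))\<^sup>2)"
    by (rule infsum_cong_neutral) auto
  also have "\<dots> = (\<Sum>\<^sub>\<infinity>h\<in>carrier G. (cmod (ell2_fun f h))\<^sup>2)"
    using infsum_reindex_bij_betw[OF bij, of "\<lambda>h. (cmod (ell2_fun f h))\<^sup>2"] by simp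
  finally show "(\<Sum>\<^sub>\<infinity>h. (cmod (if h \<in> carrier G then ell2_fun f (inv g \<otimes> h) else 0))\<^sup>2)
           = (\<Sum>\<^sub>\<infinity>h\<in>carrier G. (cmod (ell2_fun f h))\<^sup>2)" .
qed

lemma (in group) ell2_fun_left_reg:
  assumes g: "g \<in> carrier G"
  shows "ell2_fun (left_reg G g f) h = (if h \<in> carrier G then ell2_fun f (inv g \<otimes> h) else 0)"
proof -
  let ?L = "\<lambda>f. Abs_ell2 (\<lambda>h. if h \<in> carrier G then ell2_fun f (inv g \<otimes> h) else 0)"
  have L: "ell2_fun (?L f) = (\<lambda>h. if h \<in> carrier G then ell2_fun f (inv g \<otimes> h) else 0)" for f
    using left_reg_square_summable(1)[OF g] by (intro Abs_ell2_inverse) simp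
  have "bounded_linear ?L"
  proof (rule bounded_linear_intro)
    show "?L (f + f') = ?L f + ?L f'" for f f'
      by (rule ell2_eqI) (simp add: L plus_ell2.rep_eq)
    show "?L (r *\<^sub>R f) = r *\<^sub>R ?L f" for r f
      by (rule ell2_eqI) (simp add: L scaleR_ell2.rep_eq)
    show "norm (?L f) \<le> norm f * 1" for f
      unfolding norm_ell2_def L left_reg_square_summable(2)[OF g] mult_1_right
      by (intro real_sqrt_le_mono infsum_mono2 ell2_summable summable_on_subset_banach[OF ell2_summable])
        auto
  qed
  then show ?thesis
    by (simp add: left_reg_def bounded_linear_Blinfun_apply L)
qed

lemma (in group) left_reg_delta:
  assumes "g \<in> carrier G" "h \<in> carrier G"
  shows "left_reg G g (ell2_delta h) = ell2_delta (g \<otimes> h)"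
  by (rule ell2_eqI)
    (use assms in \<open>auto simp: ell2_fun_left_reg ell2_delta.rep_eq m_assoc[symmetric] inv_solve_left\<close>)

lemma (in group) left_reg_in_l2_ops: "g \<in> carrier G \<Longrightarrow> left_reg G g \<in> l2_ops (carrier G)"
  by (auto simp: l2_ops_def l2op_eq_iff scalar_op.rep_eq l2_proj.rep_eq ell2_scale.rep_eq
      ell2_restrict.rep_eq ell2_fun_left_reg intro!: ell2_eqI)

lemma (in group) reduced_cstar_subset: "reduced_cstar G \<subseteq> l2_ops (carrier G)"
  unfolding reduced_cstar_def using cstar_subalgebra_l2_ops left_reg_in_l2_ops by blast


section \<open>Amenability and summable Folner sequences\<close>

definition amenable :: "('a, 'b) monoid_scheme \<Rightarrow> bool" where
  "amenable G \<longleftrightarrow> (\<exists>\<mu> :: 'a set \<Rightarrow> real.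
     (\<forall>A\<subseteq>carrier G. 0 \<le> \<mu> A) \<and> \<mu> (carrier G) = 1 \<and>
     (\<forall>A\<subseteq>carrier G. \<forall>B\<subseteq>carrier G. A \<inter> B = {} \<longrightarrow> \<mu> (A \<union> B) = \<mu> A + \<mu> B) \<and>
     (\<forall>g\<in>carrier G. \<forall>A\<subseteq>carrier G. \<mu> (g <#\<^bsub>G\<^esub> A) = \<mu> A))"

definition folner_seq :: "('a, 'b) monoid_scheme \<Rightarrow> (nat \<Rightarrow> 'a set) \<Rightarrow> bool" where
  "folner_seq G F \<longleftrightarrow> (\<forall>n. finite (F n) \<and> F n \<noteq> {} \<and> F n \<subseteq> carrier G) \<and>
     (\<forall>s\<in>carrier G. (\<lambda>n. real (card (sym_diff (F n) (s <#\<^bsub>G\<^esub> F n))) / real (card (F n))) \<longlonglongrightarrow> 0)"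

definition summable_folner_seq :: "('a, 'b) monoid_scheme \<Rightarrow> (nat \<Rightarrow> 'a set) \<Rightarrow> bool" where
  "summable_folner_seq G F \<longleftrightarrow> folner_seq G F \<and>
     (\<exists>\<epsilon> :: nat \<Rightarrow> real. decseq \<epsilon> \<and> (\<forall>n. 0 \<le> \<epsilon> n) \<and> summable \<epsilon> \<and> suminf \<epsilon> \<le> 1 \<and>
       (\<forall>m n. n < m \<longrightarrow>
         Max {1 - real (card (F m \<inter> ((g \<otimes>\<^bsub>G\<^esub> inv\<^bsub>G\<^esub> h) <#\<^bsub>G\<^esub> F m))) / real (card (F m))
              | g h. g \<in> F n \<and> h \<in> F n} * real (card (F n)) < \<epsilon> m))"


section \<open>The approximating maps\<close>

definition compress :: "'a set \<Rightarrow> 'a l2op \<Rightarrow> 'a l2op" where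
  "compress S T = l2_proj S o\<^sub>L T o\<^sub>L l2_proj S"

text \<open>The linear extension of \<open>e\<^bsub>g,h\<^esub> \<mapsto> |S|\<^bsup>-1\<^esup> \<lambda>(g \<otimes> inv h)\<close>; see \<open>decompress_matrix_unit\<close>. An operator in
  \<open>M\<^sub>S(\<complex>)\<close> is the sum of its matrix entries times matrix units.\<close>

definition decompress :: "('a, 'b) monoid_scheme \<Rightarrow> 'a set \<Rightarrow> 'a l2op \<Rightarrow> 'a l2op" where
  "decompress G S T = (\<Sum>g\<in>S. \<Sum>h\<in>S.
     scalar_op (matrix_entry T g h / of_nat (card S)) o\<^sub>L left_reg G (g \<otimes>\<^bsub>G\<^esub> inv\<^bsub>G\<^esub> h))"

lemma decompress_matrix_unit:
  assumes "finite S" "g \<in> S" "h \<in> S"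
    and T: "\<And>f. blinfun_apply T f = ell2_scale (ell2_fun f h) (ell2_delta g)"
  shows "decompress G S T = scalar_op (1 / of_nat (card S)) o\<^sub>L left_reg G (g \<otimes>\<^bsub>G\<^esub> inv\<^bsub>G\<^esub> h)"
proof -
  let ?L = "\<lambda>a b. left_reg G (a \<otimes>\<^bsub>G\<^esub> inv\<^bsub>G\<^esub> b)"
  let ?c = "scalar_op (1 / of_nat (card S))"
  have zero: "scalar_op 0 = (0 :: 'a l2op)"
    by (rule blinfun_eqI, rule ell2_eqI) (simp add: scalar_op.rep_eq ell2_scale.rep_eq zero_ell2.rep_eq)
  have "scalar_op (matrix_entry T a b / of_nat (card S)) o\<^sub>L ?L a b
      = (if b = h then if a = g then ?c o\<^sub>L ?L a b else 0 else 0)" for a b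
    by (auto simp: matrix_entry_def T ell2_scale.rep_eq ell2_delta.rep_eq zero)
  then show ?thesis
    using assms(1-3) by (simp add: decompress_def)
qed

definition approx_multiplicative :: "'a l2op set \<Rightarrow> (nat \<Rightarrow> 'a l2op \<Rightarrow> 'a l2op) \<Rightarrow> bool" where
  "approx_multiplicative A \<psi> \<longleftrightarrow>
     (\<forall>a\<in>A. \<forall>b\<in>A. (\<lambda>n. norm (\<psi> n (a o\<^sub>L b) - (\<psi> n a o\<^sub>L \<psi> n b))) \<longlonglongrightarrow> 0)"


section \<open>Systems of matrix algebras\<close>

text \<open>A system is given by finite sets \<open>F n\<close>, with algebras \<open>l2_ops (F n)\<close> and units
  \<open>l2_proj (F n)\<close>, together with connecting maps \<open>r n\<close> from the \<open>n\<close>-th algebra to its successor.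
  Only \<open>sys_map r m n\<close> with \<open>n \<le> m\<close> is meaningful.\<close>

primrec sys_map :: "(nat \<Rightarrow> 'a l2op \<Rightarrow> 'a l2op) \<Rightarrow> nat \<Rightarrow> nat \<Rightarrow> 'a l2op \<Rightarrow> 'a l2op" where
  "sys_map r 0 n = id"
| "sys_map r (Suc m) n = (if n \<le> m then r m \<circ> sys_map r m n else id)"

definition NF_system :: "(nat \<Rightarrow> 'a set) \<Rightarrow> (nat \<Rightarrow> 'a l2op \<Rightarrow> 'a l2op) \<Rightarrow> bool" where
  "NF_system F r \<longleftrightarrow> (\<forall>k. \<forall>x\<in>l2_ops (F k). \<forall>y\<in>l2_ops (F k). \<forall>\<epsilon>>0. \<exists>M>k. \<forall>m n. m > n \<and> n > M \<longrightarrow>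
     norm ((sys_map r m k x o\<^sub>L sys_map r m k y)
           - sys_map r m n (sys_map r n k x o\<^sub>L sys_map r n k y)) < \<epsilon>)"

definition CPC_star_system :: "(nat \<Rightarrow> 'a set) \<Rightarrow> (nat \<Rightarrow> 'a l2op \<Rightarrow> 'a l2op) \<Rightarrow> bool" where
  "CPC_star_system F r \<longleftrightarrow> (\<forall>k. \<forall>x\<in>l2_ops (F k). \<forall>y\<in>l2_ops (F k). \<forall>\<epsilon>>0. \<exists>M>k.
     \<forall>n j m. n > M \<and> j > M \<and> m > max n j \<longrightarrow>
     norm ((sys_map r m k x o\<^sub>L sys_map r m k y)
           - (sys_map r m j (l2_proj (F j)) o\<^sub>L sys_map r m n (sys_map r n k x o\<^sub>L sys_map r n k y))) < \<epsilon>)"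

definition folner_connecting ::
  "('a, 'b) monoid_scheme \<Rightarrow> (nat \<Rightarrow> 'a set) \<Rightarrow> nat \<Rightarrow> 'a l2op \<Rightarrow> 'a l2op" where
  "folner_connecting G F n = compress (F (Suc n)) \<circ> decompress G (F n)"

end

theory Submission
  imports Defs
begin

text \<open>Let \<open>s\<close> have infinite order. Since \<open>F n\<close> is finite, some \<open>h \<in> F n\<close> has \<open>s \<otimes> h \<notin> F n\<close>,
  so \<open>\<psi>\<^sub>n(\<lambda>\<^sub>s)\<^sup>* \<psi>\<^sub>n(\<lambda>\<^sub>s)\<close> is a diagonal projection killing \<open>\<delta>\<^sub>h\<close>, at distance \<open>1\<close> from the unit
  \<open>\<psi>\<^sub>n(\<lambda>\<^sub>s\<^sup>* \<lambda>\<^sub>s)\<close>. The map \<open>\<phi>\<^sub>n \<circ> \<psi>\<^sub>n\<close> multiplies \<open>\<lambda>\<^sub>s\<close> by \<open>t\<^sub>n = |F n \<inter> s F n| / |F n|\<close>, and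
  \<open>\<phi>\<^sub>n\<close> sends a diagonal matrix to a scalar, its normalised trace. Hence for \<open>x = \<psi>\<^sub>k(\<lambda>\<^sub>s\<^sup>*)\<close>,
  \<open>y = \<psi>\<^sub>k(\<lambda>\<^sub>s)\<close> the product \<open>\<rho>(x) \<rho>(y)\<close> at level \<open>m\<close> kills some \<open>\<delta>\<^sub>h\<close>, whereas the product formed at
  level \<open>n < m\<close> and pushed to level \<open>m\<close> is a scalar. Summability, through
  \<open>\<Prod> t\<^sub>i \<ge> 1 - \<Sum> (1 - t\<^sub>i)\<close>, keeps that scalar at least \<open>1/4\<close>. As \<open>\<rho>\<close> is unital, the extra factor
  in the \<open>CPC\<^sup>*\<close> condition changes nothing.\<close>

section \<open>Coordinates, norms and real-linearity of the approximating maps\<close>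

lemma ell2_fun_scaleR [simp]: "ell2_fun (r *\<^sub>R f) x = of_real r * ell2_fun f x"
  by (simp add: scaleR_ell2.rep_eq)

lemma ell2_fun_l2_proj [simp]: "ell2_fun (l2_proj S f) x = (if x \<in> S then ell2_fun f x else 0)"
  by (simp add: l2_proj.rep_eq ell2_restrict.rep_eq)

lemma l2_proj_delta: "l2_proj S (ell2_delta h) = (if h \<in> S then ell2_delta h else 0)"
  by (rule ell2_eqI) (auto simp: ell2_delta.rep_eq zero_ell2.rep_eq)

lemma norm_ell2_delta [simp]: "norm (ell2_delta h) = 1"
proof -
  have "(\<Sum>\<^sub>\<infinity>x. (cmod (ell2_fun (ell2_delta h) x))\<^sup>2) = (\<Sum>\<^sub>\<infinity>x\<in>{h}. 1)"
    by (rule infsum_cong_neutral) (auto simp: ell2_delta.rep_eq)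
  then show ?thesis
    by (simp add: norm_ell2_def)
qed

lemma norm_l2op_ge:
  assumes "norm f = 1"
  shows "norm (blinfun_apply T f) \<le> norm T"
  using norm_blinfun[of T f] assms by simp

text \<open>Every coefficient that occurs below is real, so complex scalars can be traded for
  \<open>scaleR\<close>.\<close>

lemma scalar_op_of_real_compose: "scalar_op (of_real r) o\<^sub>L T = r *\<^sub>R T"
  by (rule blinfun_eqI, rule ell2_eqI)
    (simp add: scalar_op.rep_eq ell2_scale.rep_eq scaleR_blinfun.rep_eq)

lemma compress_scaleR: "compress S (r *\<^sub>R T) = r *\<^sub>R compress S T"
  by (rule blinfun_eqI) (simp add: compress_def scaleR_blinfun.rep_eq blinfun.scaleR_right)

lemma compress_in_l2_ops:
  assumes "T \<in> l2_ops S'"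
  shows "compress S T \<in> l2_ops S"
proof -
  have "blinfun_apply T (ell2_scale c f) = ell2_scale c (blinfun_apply T f)" for c f
    using assms by (auto simp: l2_ops_def l2op_eq_iff scalar_op.rep_eq)
  moreover have "l2_proj S (ell2_scale c f) = ell2_scale c (l2_proj S f)" for c f
    by (rule ell2_eqI) (simp add: ell2_scale.rep_eq)
  moreover have "l2_proj S (l2_proj S f) = l2_proj S f" for f
    by (rule ell2_eqI) simp
  ultimately show ?thesis
    by (simp add: l2_ops_def l2op_eq_iff compress_def scalar_op.rep_eq)
qed

lemma decompress_scaleR:
  fixes T :: "'a l2op"
  shows "decompress G S (r *\<^sub>R T) = r *\<^sub>R decompress G S T"
proof -
  have "scalar_op (matrix_entry (r *\<^sub>R T) g h / of_nat (card S)) o\<^sub>L U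
      = r *\<^sub>R (scalar_op (matrix_entry T g h / of_nat (card S)) o\<^sub>L U)" for g h and U :: "'a l2op"
    by (rule blinfun_eqI, rule ell2_eqI)
      (simp add: matrix_entry_def scalar_op.rep_eq ell2_scale.rep_eq scaleR_blinfun.rep_eq)
  then show ?thesis
    by (simp add: decompress_def scaleR_sum_right)
qed

lemma sys_map_folner_connecting_Suc:
  "n \<le> m \<Longrightarrow> sys_map (folner_connecting G F) (Suc m) n T
    = compress (F (Suc m)) (decompress G (F m) (sys_map (folner_connecting G F) m n T))"
  by (simp add: folner_connecting_def)

section \<open>Finite sets moved by a translation\<close>

context group
begin

text \<open>For \<open>S\<close> inside the group these \<open>h\<close> index the nonzero columns
  of the truncated translation by \<open>s\<close>.\<close>

definition stay :: "'a set \<Rightarrow> 'a \<Rightarrow> 'a set" where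
  "stay S s = {h \<in> S. s \<otimes> h \<in> S}"

definition stay_ratio :: "'a set \<Rightarrow> 'a \<Rightarrow> real" where
  "stay_ratio S s = card (stay S s) / card S"

text \<open>Left translation by \<open>s\<close> is injective and carries \<open>stay S s\<close>
  onto the intersection that the summability condition counts.\<close>

lemma stay_ratio_eq:
  assumes "S \<subseteq> carrier G" "s \<in> carrier G"
  shows "stay_ratio S s = card (S \<inter> (s <# S)) / card S"
proof -
  have "S \<inter> (s <# S) = (\<lambda>h. s \<otimes> h) ` stay S s"
    by (auto simp: stay_def l_coset_def)
  moreover have "inj_on (\<lambda>h. s \<otimes> h) (stay S s)"
    using assms by (auto simp: inj_on_def stay_def subset_iff)
  ultimately show ?thesis
    by (simp add: stay_ratio_def card_image)
qed

lemma stay_ratio_nonneg: "0 \<le> stay_ratio S s"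
  by (simp add: stay_ratio_def)

lemma stay_ratio_le_1: "finite S \<Longrightarrow> stay_ratio S s \<le> 1"
  by (cases "S = {}") (auto simp: stay_ratio_def stay_def card_gt_0_iff intro!: card_mono)

lemma stay_one: "S \<subseteq> carrier G \<Longrightarrow> stay S \<one> = S"
  by (auto simp: stay_def)

text \<open>A nonempty set stable under \<open>s\<close> contains a whole forward orbit
  \<open>s [^] n \<otimes> h\<close>, and infinite order makes that orbit infinite.\<close>

lemma infinite_order_leaves_finite:
  assumes "s \<in> carrier G" "ord s = 0" "finite S" "S \<noteq> {}" "S \<subseteq> carrier G"
  obtains h where "h \<in> S" "s \<otimes> h \<notin> S"
proof (rule ccontr)
  assume "\<not> thesis"
  then have step: "s \<otimes> h \<in> S" if "h \<in> S" for h
    using that \<open>\<And>h. h \<in> S \<Longrightarrow> s \<otimes> h \<notin> S \<Longrightarrow> thesis\<close> by blast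
  obtain h where h: "h \<in> S"
    using assms by blast
  have h': "h \<in> carrier G"
    using h assms by blast
  have "s [^] n \<otimes> h \<in> S" for n :: nat
  proof (induction n)
    case 0
    then show ?case using h h' by simp
  next
    case (Suc n)
    have "s \<otimes> (s [^] n \<otimes> h) = s [^] Suc n \<otimes> h"
      using assms(1) h' by (subst nat_pow_Suc2) (auto simp: m_assoc)
    then show ?case
      using step[OF Suc] by simp
  qed
  then have "finite (range (\<lambda>n::nat. s [^] n \<otimes> h))"
    using assms(3) by (meson finite_subset image_subsetI)
  moreover have "inj (\<lambda>n::nat. s [^] n \<otimes> h)"
  proof (rule linorder_injI)
    fix i j :: nat
    assume "i < j"
    have "s [^] (j - i) \<noteq> \<one>"
      using pow_eq_id[OF assms(1), of "j - i"] assms(2) \<open>i < j\<close> by simp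
    moreover have "s [^] j = s [^] i \<otimes> s [^] (j - i)"
      using \<open>i < j\<close> assms(1) by (simp add: nat_pow_mult)
    ultimately show "s [^] i \<otimes> h \<noteq> s [^] j \<otimes> h"
      using assms(1) h' by (auto simp: m_assoc)
  qed
  ultimately show False
    using finite_imageD by blast
qed

section \<open>Compressing and decompressing translations\<close>

lemma compress_left_reg:
  assumes "S \<subseteq> carrier G" "s \<in> carrier G"
  shows "compress S (left_reg G s) = left_reg G s o\<^sub>L l2_proj (stay S s)"
proof (rule blinfun_eqI, rule ell2_eqI)
  fix f x
  show "ell2_fun (compress S (left_reg G s) f) x = ell2_fun ((left_reg G s o\<^sub>L l2_proj (stay S s)) f) x"
    using assms by (auto simp: compress_def ell2_fun_left_reg stay_def m_assoc[symmetric])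
qed

lemma compress_left_reg_one:
  assumes "S \<subseteq> carrier G"
  shows "compress S (left_reg G \<one>) = l2_proj S"
  by (rule blinfun_eqI, rule ell2_eqI) (use assms in \<open>auto simp: compress_def ell2_fun_left_reg\<close>)

text \<open>The truncated translation is a partial isometry whose adjoint is the truncated inverse
  translation; the product is its initial projection.\<close>

lemma compress_left_reg_inv_mult:
  assumes "S \<subseteq> carrier G" "s \<in> carrier G"
  shows "compress S (left_reg G (inv s)) o\<^sub>L compress S (left_reg G s) = l2_proj (stay S s)"
  by (rule blinfun_eqI, rule ell2_eqI)
    (use assms in \<open>auto simp: compress_def ell2_fun_left_reg stay_def m_assoc[symmetric]\<close>)

text \<open>Each \<open>h \<in> A\<close> contributes one matrix unit, at row
  \<open>s \<otimes> h\<close> and column \<open>h\<close>, and all of these have the same image.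
  Only their number matters.\<close>

lemma decompress_left_reg_proj:
  assumes S: "finite S" "S \<subseteq> carrier G" and s: "s \<in> carrier G"
    and A: "A \<subseteq> stay S s"
  shows "decompress G S (left_reg G s o\<^sub>L l2_proj A) = (card A / card S) *\<^sub>R left_reg G s"
proof -
  let ?c = "1 / real (card S)"
  have AS: "A \<subseteq> S" using A by (auto simp: stay_def)
  have entry: "scalar_op (matrix_entry (left_reg G s o\<^sub>L l2_proj A) g h / of_nat (card S)) o\<^sub>L left_reg G (g \<otimes> inv h)
     = (if g = s \<otimes> h then if h \<in> A then ?c *\<^sub>R left_reg G s else 0 else 0)"
    if "g \<in> S" "h \<in> S" for g h
  proof -
    have gh: "g \<in> carrier G" "h \<in> carrier G" using that S by auto
    have "matrix_entry (left_reg G s o\<^sub>L l2_proj A) g h / of_nat (card S)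
        = of_real (if g = s \<otimes> h \<and> h \<in> A then ?c else 0)"
      using gh s by (auto simp: matrix_entry_def l2_proj_delta left_reg_delta ell2_delta.rep_eq
          blinfun.zero_right zero_ell2.rep_eq)
    moreover have "g \<otimes> inv h = s" if "g = s \<otimes> h"
      using that gh s by (simp add: m_assoc)
    ultimately show ?thesis
      by (simp only: scalar_op_of_real_compose) simp
  qed
  have "decompress G S (left_reg G s o\<^sub>L l2_proj A)
     = (\<Sum>h\<in>S. \<Sum>g\<in>S. if g = s \<otimes> h then if h \<in> A then ?c *\<^sub>R left_reg G s else 0 else 0)"
    unfolding decompress_def by (subst sum.swap) (intro sum.cong refl entry)
  \<comment> \<open>For \<open>h \<in> A\<close> the one surviving row \<open>s \<otimes> h\<close>
    lies in \<open>S\<close> because \<open>A \<subseteq> stay S s\<close>.\<close>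
  also have "\<dots> = (\<Sum>h\<in>S. if h \<in> A then ?c *\<^sub>R left_reg G s else 0)"
    using S A by (intro sum.cong refl) (auto simp: stay_def)
  also have "\<dots> = (\<Sum>h\<in>A. ?c *\<^sub>R left_reg G s)"
    using S AS by (simp add: sum.If_cases Int_absorb1)
  finally show ?thesis
    by (simp add: sum_constant_scaleR)
qed

lemma decompress_compress_left_reg:
  assumes "finite S" "S \<subseteq> carrier G" "s \<in> carrier G"
  shows "decompress G S (compress S (left_reg G s)) = stay_ratio S s *\<^sub>R left_reg G s"
  using decompress_left_reg_proj[OF assms subset_refl] assms
  by (simp add: compress_left_reg stay_ratio_def)

lemma decompress_proj:
  assumes "finite S" "S \<subseteq> carrier G" "A \<subseteq> S"
  shows "decompress G S (l2_proj A) = (card A / card S) *\<^sub>R left_reg G \<one>"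
proof -
  have "l2_proj A = left_reg G \<one> o\<^sub>L l2_proj A"
    by (rule blinfun_eqI, rule ell2_eqI) (use assms in \<open>auto simp: ell2_fun_left_reg\<close>)
  then show ?thesis
    using decompress_left_reg_proj[of S \<one> A] assms by (simp add: stay_one)
qed

section \<open>Iterated connecting maps\<close>

text \<open>The first connecting map sees \<open>T\<close> only through \<open>decompress\<close>,
  so one lemma covers truncated translations and diagonal matrices alike. The loss at level
  \<open>n\<close> sits in \<open>a\<close>; each later level below \<open>m\<close> costs one
  ratio.\<close>

lemma sys_map_left_reg:
  assumes F: "\<And>n. finite (F n)" "\<And>n. F n \<subseteq> carrier G" and g: "g \<in> carrier G"
    and T: "decompress G (F n) T = a *\<^sub>R left_reg G g" and "n < m"
  shows "sys_map (folner_connecting G F) m n T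
     = (a * (\<Prod>i\<in>{Suc n..<m}. stay_ratio (F i) g)) *\<^sub>R compress (F m) (left_reg G g)"
  using \<open>n < m\<close>
proof (induction m)
  case (Suc m)
  show ?case
  proof (cases "n = m")
    case True
    have "sys_map r m m = id" for r :: "nat \<Rightarrow> 'a l2op \<Rightarrow> 'a l2op"
      by (cases m) auto
    then show ?thesis
      using True T by (simp add: folner_connecting_def compress_scaleR)
  next
    case False
    then have "n < m" using Suc.prems by simp
    then show ?thesis
      by (simp add: sys_map_folner_connecting_Suc Suc.IH decompress_scaleR compress_scaleR
          decompress_compress_left_reg F g mult.assoc del: sys_map.simps)
  qed
qed simp

lemma sys_map_compress_left_reg:
  assumes "\<And>n. finite (F n)" "\<And>n. F n \<subseteq> carrier G" "g \<in> carrier G" "k < m"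
  shows "sys_map (folner_connecting G F) m k (compress (F k) (left_reg G g))
     = (\<Prod>i\<in>{k..<m}. stay_ratio (F i) g) *\<^sub>R compress (F m) (left_reg G g)"
  using sys_map_left_reg[where F=F, OF assms(1-3) decompress_compress_left_reg[OF assms(1-3)] assms(4)]
    assms(4) by (simp add: prod.atLeast_Suc_lessThan)

text \<open>The first decompression replaces a diagonal projection by its normalised trace; the
  identity translation then loses nothing at later levels.\<close>

lemma sys_map_scaled_proj:
  assumes F: "\<And>n. finite (F n)" "\<And>n. F n \<noteq> {}" "\<And>n. F n \<subseteq> carrier G" "n < m" "A \<subseteq> F n"
  shows "sys_map (folner_connecting G F) m n (r *\<^sub>R l2_proj A)
     = (r * (card A / card (F n))) *\<^sub>R l2_proj (F m)"
proof -
  have "stay_ratio (F i) \<one> = 1" for i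
    using F by (simp add: stay_ratio_def stay_one)
  moreover have "decompress G (F n) (r *\<^sub>R l2_proj A) = (r * (card A / card (F n))) *\<^sub>R left_reg G \<one>"
    using F by (simp add: decompress_scaleR decompress_proj)
  ultimately show ?thesis
    using sys_map_left_reg[where F=F, of \<one>, OF F(1) F(3) one_closed _ F(4)] F(3)
    by (simp add: compress_left_reg_one)
qed

section \<open>Lower bounds from summability\<close>

lemma summable_folner_stay_ratio:
  assumes "summable_folner_seq G F" "s \<in> carrier G" "s \<noteq> \<one>"
  obtains k where "\<And>m. 1/2 \<le> (\<Prod>i\<in>{k..<m}. stay_ratio (F i) s)"
    "\<And>m. 1/2 \<le> (\<Prod>i\<in>{k..<m}. stay_ratio (F i) (inv s))"
proof -
  let ?D = "\<lambda>m n. {1 - real (card (F m \<inter> ((g \<otimes> inv h) <# F m))) / real (card (F m))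
              | g h. g \<in> F n \<and> h \<in> F n}"
  define defect where "defect m n = Max (?D m n)" for m n
  from assms(1) obtain \<epsilon> :: "nat \<Rightarrow> real" where "folner_seq G F" and
    \<epsilon>: "\<And>n. 0 \<le> \<epsilon> n" "summable \<epsilon>" "suminf \<epsilon> \<le> 1" and
    M: "\<And>m n. n < m \<Longrightarrow> defect m n * real (card (F n)) < \<epsilon> m"
    unfolding summable_folner_seq_def defect_def[symmetric] by metis
  then have F: "\<And>n. finite (F n)" "\<And>n. F n \<noteq> {}" "\<And>n. F n \<subseteq> carrier G" and
    lim: "(\<lambda>n. real (card (sym_diff (F n) (s <# F n))) / real (card (F n))) \<longlonglongrightarrow> 0"
    using assms(2) by (simp_all add: folner_seq_def)
  \<comment> \<open>The threshold is 1 because a translate disjoint from \<open>F k\<close> would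
    put all of \<open>F k\<close> into the symmetric difference.\<close>
  obtain k where k: "real (card (sym_diff (F k) (s <# F k))) / real (card (F k)) < 1"
    using order_tendstoD(2)[OF lim, of 1] by (auto simp: eventually_sequentially)
  have pos: "card (F n) > 0" for n
    using F by (simp add: card_gt_0_iff)
  \<comment> \<open>Thus \<open>s\<close> is a quotient of two elements of \<open>F k\<close>, to which the summability bound applies.\<close>
  have "F k \<inter> (s <# F k) \<noteq> {}"
  proof
    assume "F k \<inter> (s <# F k) = {}"
    moreover have "finite (s <# F k)"
      using F by (simp add: l_coset_def)
    ultimately have "card (F k) \<le> card (sym_diff (F k) (s <# F k))"
      using F by (intro card_mono) auto
    then show False
      using k pos[of k] by (simp add: divide_simps)
  qed
  then obtain h where h: "h \<in> F k" "s \<otimes> h \<in> F k"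
    by (auto simp: l_coset_def)
  have hc: "h \<in> carrier G" using h F by blast
  have "s \<otimes> h \<noteq> h"
    using assms hc by simp
  \<comment> \<open>The factor \<open>card (F k)\<close> in the summability condition is thus at
    least 2, which halves the total loss from 1 to 1/2.\<close>
  then have card2: "2 \<le> card (F k)"
    using h F card_mono[of "F k" "{h, s \<otimes> h}"] by simp
  \<comment> \<open>The pair is kept general to serve both \<open>s\<close> and
    \<open>inv s\<close>. The product starts at \<open>Suc k\<close> since the condition only
    concerns levels strictly after \<open>k\<close>.\<close>
  have bound: "1/2 \<le> (\<Prod>i\<in>{Suc k..<m}. stay_ratio (F i) (g \<otimes> inv g'))"
    if g: "g \<in> F k" "g' \<in> F k" for g g' m
  proof -
    let ?t = "\<lambda>i. stay_ratio (F i) (g \<otimes> inv g')"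
    have gc: "g \<otimes> inv g' \<in> carrier G"
      using g F by blast
    have "(1 - ?t i) * 2 \<le> \<epsilon> i" if "k < i" for i
    proof -
      have "(1 - ?t i) * 2 \<le> (1 - ?t i) * card (F k)"
        using card2 stay_ratio_le_1[OF F(1)] by (intro mult_left_mono) auto
      also have "\<dots> \<le> defect i k * card (F k)"
        unfolding defect_def
      proof (rule mult_right_mono[OF Max_ge])
        show "finite (?D i k)"
          using F by (intro finite_image_set2) auto
        show "1 - ?t i \<in> ?D i k"
          using g gc F by (auto simp: stay_ratio_eq)
      qed simp
      finally show ?thesis
        using M[OF that] by simp
    qed
    then have "(\<Sum>i\<in>{Suc k..<m}. 1 - ?t i) \<le> (\<Sum>i\<in>{Suc k..<m}. \<epsilon> i / 2)"
      by (intro sum_mono) (simp add: field_simps)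
    also have "\<dots> \<le> 1/2"
      using sum_le_suminf[OF \<epsilon>(2), of "{Suc k..<m}"] \<epsilon> by (simp flip: sum_divide_distrib)
    finally have "1/2 \<le> 1 - (\<Sum>i\<in>{Suc k..<m}. 1 - ?t i)"
      by simp
    also have "\<dots> \<le> (\<Prod>i\<in>{Suc k..<m}. 1 - (1 - ?t i))"
      using F by (intro Weierstrass_prod_ineq) (auto simp: stay_ratio_nonneg stay_ratio_le_1)
    finally show ?thesis by simp
  qed
  have "(s \<otimes> h) \<otimes> inv h = s"
    using hc assms(2) by (simp add: m_assoc)
  moreover have "h \<otimes> inv (s \<otimes> h) = inv s"
    using hc assms(2) by (simp add: inv_mult_group m_assoc[symmetric])
  ultimately show thesis
    using that[of "Suc k"] bound[OF h(2) h(1)] bound[OF h] by simp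
qed

section \<open>Failure of multiplicativity\<close>

text \<open>At the unit vector \<open>ell2_delta h\<close> the first projection vanishes and only
  the multiple of the second remains.\<close>

lemma norm_diff_scaled_proj_ge:
  assumes "h \<in> S" "h \<notin> A" "0 \<le> b"
  shows "b \<le> norm (a *\<^sub>R l2_proj A - b *\<^sub>R l2_proj S)"
proof -
  have "(a *\<^sub>R l2_proj A - b *\<^sub>R l2_proj S) (ell2_delta h) = - (b *\<^sub>R ell2_delta h)"
    using assms by (simp add: minus_blinfun.rep_eq scaleR_blinfun.rep_eq l2_proj_delta)
  then show ?thesis
    using norm_l2op_ge[of "ell2_delta h" "a *\<^sub>R l2_proj A - b *\<^sub>R l2_proj S"] assms by simp
qed

lemma not_approx_multiplicative_compress:
  assumes F: "\<And>n. finite (F n)" "\<And>n. F n \<noteq> {}" "\<And>n. F n \<subseteq> carrier G"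
    and s: "s \<in> carrier G" "ord s = 0"
  shows "\<not> approx_multiplicative (reduced_cstar G) (\<lambda>n. compress (F n))"
proof
  let ?d = "\<lambda>n. norm (compress (F n) (left_reg G (inv s) o\<^sub>L left_reg G s)
      - (compress (F n) (left_reg G (inv s)) o\<^sub>L compress (F n) (left_reg G s)))"
  assume "approx_multiplicative (reduced_cstar G) (\<lambda>n. compress (F n))"
  moreover have "left_reg G g \<in> reduced_cstar G" if "g \<in> carrier G" for g
    using that by (auto simp: reduced_cstar_def)
  ultimately have d: "?d \<longlonglongrightarrow> 0"
    using s by (auto simp: approx_multiplicative_def)
  then obtain n where "?d n < 1"
    using order_tendstoD(2)[OF d, of 1] by (auto simp: eventually_sequentially)
  moreover have "1 \<le> ?d n"
  proof -
    obtain h where h: "h \<in> F n" "s \<otimes> h \<notin> F n"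
      using infinite_order_leaves_finite[OF s F] .
    have "left_reg G (inv s) o\<^sub>L left_reg G s = left_reg G \<one>"
      by (rule blinfun_eqI, rule ell2_eqI)
        (use s in \<open>auto simp: ell2_fun_left_reg m_assoc[symmetric]\<close>)
    then have "?d n = norm (1 *\<^sub>R l2_proj (stay (F n) s) - 1 *\<^sub>R l2_proj (F n))"
      using F s by (simp add: compress_left_reg_one compress_left_reg_inv_mult norm_minus_commute)
    then show ?thesis
      using norm_diff_scaled_proj_ge[of h "F n" "stay (F n) s" 1 1] h by (simp add: stay_def)
  qed
  ultimately show False by simp
qed

text \<open>The bound is uniform in \<open>n\<close> and \<open>m\<close>, so no threshold can work.
  The second claim takes the unit from level \<open>n\<close> itself, which suffices to refute the
  \<open>CPC\<^sup>*\<close> condition.\<close>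

lemma sys_map_mult_defect:
  assumes F: "\<And>n. finite (F n)" "\<And>n. F n \<noteq> {}" "\<And>n. F n \<subseteq> carrier G"
    and s: "s \<in> carrier G" "ord s = 0" and kn: "k < n" "n < m"
    and c: "\<And>m. 1/2 \<le> (\<Prod>i\<in>{k..<m}. stay_ratio (F i) s)"
    "\<And>m. 1/2 \<le> (\<Prod>i\<in>{k..<m}. stay_ratio (F i) (inv s))"
  defines "\<rho> \<equiv> sys_map (folner_connecting G F)"
    and "x \<equiv> compress (F k) (left_reg G (inv s))" and "y \<equiv> compress (F k) (left_reg G s)"
  shows "1/4 \<le> norm ((\<rho> m k x o\<^sub>L \<rho> m k y) - \<rho> m n (\<rho> n k x o\<^sub>L \<rho> n k y))" (is ?NF)
    and "\<rho> m n (l2_proj (F n)) o\<^sub>L \<rho> m n (\<rho> n k x o\<^sub>L \<rho> n k y) = \<rho> m n (\<rho> n k x o\<^sub>L \<rho> n k y)" (is ?CPC)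
proof -
  define a where "a = (\<lambda>m. \<Prod>i\<in>{k..<m}. stay_ratio (F i) (inv s))"
  define b where "b = (\<lambda>m. \<Prod>i\<in>{k..<m}. stay_ratio (F i) s)"
  have prod: "\<rho> m k x o\<^sub>L \<rho> m k y = (a m * b m) *\<^sub>R l2_proj (stay (F m) s)" if "k < m" for m
    using that F s unfolding \<rho>_def x_def y_def a_def b_def
    by (simp add: sys_map_compress_left_reg bounded_bilinear.scaleR_left[OF bounded_bilinear_blinfun_compose]
          bounded_bilinear.scaleR_right[OF bounded_bilinear_blinfun_compose] flip: compress_left_reg_inv_mult)
  \<comment> \<open>The normalised trace of the level-\<open>n\<close> product is the ratio at
    \<open>n\<close>, so pushing forward extends the product in \<open>b\<close> by one
    factor.\<close>
  have b: "b (Suc n) = b n * (card (stay (F n) s) / card (F n))"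
    using kn by (simp add: b_def stay_ratio_def)
  have sub: "stay (F n) s \<subseteq> F n"
    by (auto simp: stay_def)
  have lim: "\<rho> m n (\<rho> n k x o\<^sub>L \<rho> n k y) = (a n * b (Suc n)) *\<^sub>R l2_proj (F m)"
    unfolding prod[OF kn(1)] b unfolding \<rho>_def
    using sys_map_scaled_proj[where F=F, OF F kn(2) sub] by (simp add: mult.assoc)
  obtain h where h: "h \<in> F m" "s \<otimes> h \<notin> F m"
    using infinite_order_leaves_finite[OF s F] .
  have "1/2 \<le> a n" "1/2 \<le> b (Suc n)"
    using c unfolding a_def b_def by blast+
  then have "1/4 \<le> a n * b (Suc n)"
    using mult_mono[of "1/2" "a n" "1/2" "b (Suc n)"] by simp
  also have "\<dots> \<le> norm ((a m * b m) *\<^sub>R l2_proj (stay (F m) s) - (a n * b (Suc n)) *\<^sub>R l2_proj (F m))"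
    by (rule norm_diff_scaled_proj_ge[OF h(1)])
      (use h calculation in \<open>auto simp: stay_def\<close>)
  finally show ?NF
    using kn by (simp only: lim prod[of m])
  have "\<rho> m n (l2_proj (F n)) = l2_proj (F m)"
    using sys_map_scaled_proj[where F=F, OF F kn(2) subset_refl, of 1] F unfolding \<rho>_def by simp
  moreover have "l2_proj (F m) o\<^sub>L l2_proj (F m) = l2_proj (F m)"
    by (rule blinfun_eqI, rule ell2_eqI) simp
  ultimately show ?CPC
    by (simp add: lim bounded_bilinear.scaleR_right[OF bounded_bilinear_blinfun_compose])
qed

end

theorem proposition5p2:
  fixes G :: "('a, 'b) monoid_scheme" and F :: "nat \<Rightarrow> 'a set"
  assumes "group G"
    and "countable (carrier G)"
    and "amenable G"
    and "summable_folner_seq G F"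
    and "\<exists>s\<in>carrier G. group.ord G s = 0"
  shows "\<not> approx_multiplicative (reduced_cstar G) (\<lambda>n. compress (F n))
    \<and> \<not> NF_system F (folner_connecting G F)
    \<and> \<not> CPC_star_system F (folner_connecting G F)"
proof -
  interpret group G by fact
  from assms(5) obtain s where s: "s \<in> carrier G" "group.ord G s = 0" by blast
  have F: "\<And>n. finite (F n)" "\<And>n. F n \<noteq> {}" "\<And>n. F n \<subseteq> carrier G"
    using assms(4) by (auto simp: summable_folner_seq_def folner_seq_def)
  have "s \<noteq> \<one>\<^bsub>G\<^esub>"
    using s(2) by auto
  then obtain k where c: "\<And>m. 1/2 \<le> (\<Prod>i\<in>{k..<m}. group.stay_ratio G (F i) s)"
    "\<And>m. 1/2 \<le> (\<Prod>i\<in>{k..<m}. group.stay_ratio G (F i) (inv\<^bsub>G\<^esub> s))"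
    using summable_folner_stay_ratio[OF assms(4) s(1)] by blast
  define x y where "x = compress (F k) (left_reg G (inv\<^bsub>G\<^esub> s))" and "y = compress (F k) (left_reg G s)"
  have xy: "x \<in> l2_ops (F k)" "y \<in> l2_ops (F k)"
    unfolding x_def y_def using s by (auto intro!: compress_in_l2_ops left_reg_in_l2_ops)
  let ?\<rho> = "sys_map (folner_connecting G F)"
  note defect = sys_map_mult_defect[where F=F, OF F s _ _ c, folded x_def y_def]
  have "\<not> NF_system F (folner_connecting G F)"
  proof
    assume "NF_system F (folner_connecting G F)"
    then have "\<exists>M>k. \<forall>m n. m > n \<and> n > M \<longrightarrow>
        norm ((?\<rho> m k x o\<^sub>L ?\<rho> m k y) - ?\<rho> m n (?\<rho> n k x o\<^sub>L ?\<rho> n k y)) < 1/4"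
      using xy unfolding NF_system_def
      by (elim allE[of _ k] ballE[of _ _ x] ballE[of _ _ y] allE[of _ "1/4"]) simp_all
    then obtain M where "M > k" and M: "\<And>m n. m > n \<and> n > M \<Longrightarrow>
        norm ((?\<rho> m k x o\<^sub>L ?\<rho> m k y) - ?\<rho> m n (?\<rho> n k x o\<^sub>L ?\<rho> n k y)) < 1/4" by blast
    then show False
      using defect(1)[of "Suc M" "Suc (Suc M)"] M[of "Suc M" "Suc (Suc M)"] by simp
  qed
  moreover have "\<not> CPC_star_system F (folner_connecting G F)"
  proof
    assume "CPC_star_system F (folner_connecting G F)"
    then have "\<exists>M>k. \<forall>n j m. n > M \<and> j > M \<and> m > max n j \<longrightarrow>
        norm ((?\<rho> m k x o\<^sub>L ?\<rho> m k y)
          - (?\<rho> m j (l2_proj (F j)) o\<^sub>L ?\<rho> m n (?\<rho> n k x o\<^sub>L ?\<rho> n k y))) < 1/4"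
      using xy unfolding CPC_star_system_def
      by (elim allE[of _ k] ballE[of _ _ x] ballE[of _ _ y] allE[of _ "1/4"]) simp_all
    then obtain M where "M > k" and M: "\<And>n j m. n > M \<and> j > M \<and> m > max n j \<Longrightarrow>
        norm ((?\<rho> m k x o\<^sub>L ?\<rho> m k y)
          - (?\<rho> m j (l2_proj (F j)) o\<^sub>L ?\<rho> m n (?\<rho> n k x o\<^sub>L ?\<rho> n k y))) < 1/4" by blast
    \<comment> \<open>With \<open>j = n\<close> the unit factor is absorbed, leaving the NF
      defect.\<close>
    then show False
      using defect[of "Suc M" "Suc (Suc M)"] M[of "Suc M" "Suc M" "Suc (Suc M)"] by simp
  qed
  ultimately show ?thesis
    using not_approx_multiplicative_compress[where F=F, OF F s] by blast
qed

end
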